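(* Let $\mathcal{P}$ be a probability measure on a Banach space $\mathcal{B}$ of type $p\in(1,2]$ and type constant $T$. Let $\gamma,\Delta>0$ and let $\eta=\frac{p}{p+\gamma(p-1)}$. If $\mathbb{E}_{\mathcal{P}}\|x\|^{\gamma}=r^{\gamma}<\infty$, then the annealed entropy of gap-tolerant classifiers in $\mathcal{B}$, where the gap is $\Delta$, satisfies, for every number of samples $\ell$, $$H_{ann}^{\Lambda}(\ell)\le\left(\eta^{-\eta}(1-\eta)^{-1+\eta}\left(\frac{\ell}{\ln(\ell+1)}\left(\frac{3Tr}{\Delta}\right)^{\gamma}\right)^{\eta}+64\right)\ln(\ell+1).$$
   Context: A Banach space $\mathcal{B}$ has (Rademacher) type $p$ if there is $T<\infty$ such that for all $n$ and all $x_1,\dots,x_n\in\mathcal{B}$, $\mathbb{E}_\epsilon\big[\|\sum_{i=1}^n\epsilon_i x_i\|^p\big]\le T^p\sum_{i=1}^n\|x_i\|^p$, where $\epsilon_i$ are independent uniform $\pm1$ signs; the smallest such $T$ is the type constant. A gap-tolerant classifier with gap (margin) $\Delta$ consists of an oriented affine hyperplane together with its margin, the set of points at norm-distance less than $\Delta$ from the hyperplane. Points outside the margin are labeled $+1$ or $-1$ according to the side of the hyperplane on which they lie; points in the margin receive no label and are declared "correct". Let $\Lambda$ be the set of all gap-tolerant classifiers with gap $\Delta$. For points $z_1,\dots,z_\ell$, $N^{\Lambda}(z_1,\dots,z_\ell)$ is the number of labelings of $\{z_1,\dots,z_\ell\}$ by $\pm1$ for which there is a classifier in $\Lambda$ that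 predicts incorrectly the label of every $z_i$ (so every $z_i$ lies outside the margin, on the side opposite to its label). The annealed entropy with respect to $\mathcal{P}$ is $H_{ann}^{\Lambda}(\ell):=\ln\mathbb{E}\,N^{\Lambda}(z_1,\dots,z_\ell)$, with $z_1,\dots,z_\ell$ i.i.d. from $\mathcal{P}$. *)

theory Defs
  imports "HOL-Probability.Probability"
begin

definition rademacher_signs :: "nat \<Rightarrow> (nat \<Rightarrow> real) pmf" where
  "rademacher_signs n = Pi_pmf {..<n} 0 (\<lambda>_. pmf_of_set {-1, 1})"

definition type_bounds :: "'a::real_normed_vector itself \<Rightarrow> real \<Rightarrow> real set" where
  "type_bounds _ p = {T. 0 \<le> T \<and>
     (\<forall>n (x :: nat \<Rightarrow> 'a).
        measure_pmf.expectation (rademacher_signs n)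
          (\<lambda>\<epsilon>. norm (\<Sum>i<n. \<epsilon> i *\<^sub>R x i) powr p)
        \<le> T powr p * (\<Sum>i<n. norm (x i) powr p))}"

definition has_type :: "'a::real_normed_vector itself \<Rightarrow> real \<Rightarrow> bool" where
  "has_type B p \<longleftrightarrow> type_bounds B p \<noteq> {}"

definition type_constant :: "'a::real_normed_vector itself \<Rightarrow> real \<Rightarrow> real" where
  "type_constant B p = Inf (type_bounds B p)"

text \<open>The infimum is attained, so it is indeed the smallest admissible constant.\<close>

lemma type_constant_least:
  fixes B :: "'a::real_normed_vector itself"
  assumes "0 < p" and "has_type B p"
  shows "type_constant B p \<in> type_bounds B p"
    and "T \<in> type_bounds B p \<Longrightarrow> type_constant B p \<le> T"
proof -
  have bdd: "bdd_below (type_bounds B p)"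
    by (rule bdd_belowI[where m = 0]) (simp add: type_bounds_def)
  have "continuous_on {0..} (\<lambda>T :: real. T powr p)"
    by (rule continuous_on_powr') (use \<open>0 < p\<close> in \<open>auto intro: continuous_intros\<close>)
  then have cl: "closed {T \<in> {0..}. c \<le> T powr p * d}" for c d :: real
    by (intro continuous_on_closed_Collect_le continuous_on_const continuous_on_mult closed_atLeast)
  have "type_bounds B p = {0..} \<inter> (\<Inter>n. \<Inter>x :: nat \<Rightarrow> 'a. {T \<in> {0..}.
      measure_pmf.expectation (rademacher_signs n)
          (\<lambda>\<epsilon>. norm (\<Sum>i<n. \<epsilon> i *\<^sub>R x i) powr p)
        \<le> T powr p * (\<Sum>i<n. norm (x i) powr p)})"
    by (auto simp: type_bounds_def)
  then have "closed (type_bounds B p)"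
    by (simp only:) (intro closed_Int closed_INT ballI cl closed_atLeast)
  then show "type_constant B p \<in> type_bounds B p"
    using assms(2) bdd unfolding type_constant_def has_type_def
    by (intro closed_contains_Inf) auto
  show "type_constant B p \<le> T" if "T \<in> type_bounds B p"
    unfolding type_constant_def using that bdd by (rule cInf_lower)
qed

text \<open>
  An oriented affine hyperplane is given by a nonzero continuous linear functional \<open>f\<close> and an
  offset \<open>b\<close>; the positive side is \<open>f x > b\<close>.  Discontinuous functionals would add nothing: their
  level sets are dense, so every point would lie in the margin.  \<open>None\<close> stands for
  ``in the margin, no label''.
\<close>

definition gap_tolerant_classifier ::
  "real \<Rightarrow> ('a::real_normed_vector \<Rightarrow>\<^sub>L real) \<Rightarrow> real \<Rightarrow> 'a \<Rightarrow> int option" where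
  "gap_tolerant_classifier \<Delta> f b x =
     (if infdist x {u. blinfun_apply f u = b} < \<Delta> then None
      else if blinfun_apply f x > b then Some 1
      else Some (-1))"

definition gap_tolerant_classifiers :: "real \<Rightarrow> ('a::real_normed_vector \<Rightarrow> int option) set" where
  "gap_tolerant_classifiers \<Delta> = {gap_tolerant_classifier \<Delta> f b | f b. f \<noteq> 0}"

definition predicts_incorrectly :: "('a \<Rightarrow> int option) \<Rightarrow> 'a \<Rightarrow> int \<Rightarrow> bool" where
  "predicts_incorrectly h x y \<longleftrightarrow> (\<exists>s. h x = Some s \<and> s \<noteq> y)"

definition num_labelings :: "('a \<Rightarrow> int option) set \<Rightarrow> 'a set \<Rightarrow> nat" where
  "num_labelings \<Lambda> A =
     card {y \<in> A \<rightarrow>\<^sub>E {-1, 1}. \<exists>h\<in>\<Lambda>. \<forall>x\<in>A. predicts_incorrectly h x (y x)}"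

text \<open>
  On a nonseparable space the product of Borel \<open>\<sigma>\<close>-algebras can be strictly smaller than the Borel
  \<open>\<sigma>\<close>-algebra of the product, so the number of labelings need not be a measurable function of the
  sample.  The expectation is therefore read as an outer expectation, which is the ordinary
  expectation whenever the function is measurable.
\<close>

definition outer_expectation :: "'a measure \<Rightarrow> ('a \<Rightarrow> ennreal) \<Rightarrow> ennreal" where
  "outer_expectation M f =
     (INF g\<in>{g \<in> borel_measurable M. \<forall>x\<in>space M. f x \<le> g x}. \<integral>\<^sup>+ x. g x \<partial>M)"

lemma outer_expectation_eq_nn_integral:
  assumes "f \<in> borel_measurable M"
  shows "outer_expectation M f = (\<integral>\<^sup>+ x. f x \<partial>M)"
  unfolding outer_expectation_def
proof (rule antisym)
  show "(INF g\<in>{g \<in> borel_measurable M. \<forall>x\<in>space M. f x \<le> g x}. \<integral>\<^sup>+ x. g x \<partial>M)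
      \<le> (\<integral>\<^sup>+ x. f x \<partial>M)"
    using assms by (intro INF_lower) auto
  show "(\<integral>\<^sup>+ x. f x \<partial>M)
      \<le> (INF g\<in>{g \<in> borel_measurable M. \<forall>x\<in>space M. f x \<le> g x}. \<integral>\<^sup>+ x. g x \<partial>M)"
    by (intro INF_greatest nn_integral_mono) auto
qed

lemma outer_expectation_eq_expectation:
  fixes f :: "'a \<Rightarrow> real"
  assumes "integrable M f" and "\<And>x. 0 \<le> f x"
  shows "enn2real (outer_expectation M (\<lambda>x. ennreal (f x))) = (\<integral>x. f x \<partial>M)"
  using assms
  by (simp add: outer_expectation_eq_nn_integral nn_integral_eq_integral integral_nonneg)

text \<open>
  Every labeling count is at most \<open>2 ^ l\<close>, so the outer expectation is finite.  It is \<open>0\<close> only if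
  there is no classifier at all (the zero space); there \<open>ln 0 = 0\<close> replaces \<open>-\<infinity>\<close>.
\<close>

definition annealed_entropy :: "('a \<Rightarrow> int option) set \<Rightarrow> 'a measure \<Rightarrow> nat \<Rightarrow> real" where
  "annealed_entropy \<Lambda> P l =
     ln (enn2real (outer_expectation (\<Pi>\<^sub>M i\<in>{..<l}. P)
       (\<lambda>z. ennreal (real (num_labelings \<Lambda> (z ` {..<l}))))))"

end

theory Submission
  imports Defs
begin

text \<open>
  Fix a radius \<open>R > 0\<close>.  The type inequality bounds the size of a set shattered inside the ball of
  radius \<open>R\<close> by \<open>max 1 ((2 T R / \<Delta>) powr (p / (p - 1)))\<close>.  By Pajor's form of the Sauer--Shelah lemma
  the number of labelings is at most \<open>(l + 1) ^ d * 2 ^ k\<close>, where \<open>d\<close> is this bound and \<open>k\<close> counts the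
  sample points outside the ball.  By independence and Markov's inequality the expectation of
  \<open>2 ^ k\<close> is at most \<open>(1 + (r / R) powr \<gamma>) ^ l\<close>.  Taking logarithms leaves
  \<open>l (r / R) powr \<gamma> + d ln (l + 1)\<close>, and minimizing over \<open>R\<close> gives the exponent \<open>\<eta>\<close> and its constant.
\<close>

section \<open>Shattering\<close>

text \<open>Inclusion is enough: a trace on \<open>S\<close> is a subset of \<open>S\<close> in any
  case, so this says that every subset of \<open>S\<close> is a trace.\<close>

definition shatters :: "'a set set \<Rightarrow> 'a set \<Rightarrow> bool" where
  "shatters F S \<longleftrightarrow> Pow S \<subseteq> (\<lambda>X. X \<inter> S) ` F"

lemma shattersD:
  assumes "shatters F S" and "B \<subseteq> S"
  obtains X where "X \<in> F" and "X \<inter> S = B"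
  using assms unfolding shatters_def by blast

text \<open>Pajor's inequality, by induction on the ground set. Splitting \<open>F\<close> by
  membership of \<open>a\<close> and then deleting \<open>a\<close> gives two families on
  \<open>A\<close>, whose sizes add up to those of their union and intersection. Sets shattered by
  the union are shattered by \<open>F\<close>; sets shattered by the intersection stay shattered by
  \<open>F\<close> even with \<open>a\<close> added.\<close>

lemma card_le_card_shattered:
  assumes "finite A" and "F \<subseteq> Pow A"
  shows "card F \<le> card {S. S \<subseteq> A \<and> shatters F S}"
  using assms
proof (induction A arbitrary: F rule: finite_induct)
  case empty
  show ?case
  proof (cases "F = {}")
    case False
    then have F: "F = {{}}" using empty by auto
    then have "{S. S \<subseteq> {} \<and> shatters F S} = {{}}" by (auto simp: shatters_def)
    then show ?thesis using F by simp
  qed simp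
next
  case (insert a A)
  define G where "G = {X \<in> F. a \<notin> X}"
  define K where "K = {X \<in> F. a \<in> X}"
  define H where "H = (\<lambda>X. X - {a}) ` K"
  let ?Sh = "\<lambda>A F. {S. S \<subseteq> A \<and> shatters F S}"
  have GA: "G \<subseteq> Pow A" and HA: "H \<subseteq> Pow A"
    using insert.prems by (auto simp: G_def H_def K_def)
  have fin: "finite F" "finite G" "finite H" "finite K"
    using insert.hyps(1) insert.prems GA HA
    by (auto intro: finite_subset simp: G_def K_def)
  have H_iff: "X \<in> H \<longleftrightarrow> a \<notin> X \<and> insert a X \<in> F" for X
    unfolding H_def K_def image_def by (auto simp: insert_absorb intro!: bexI[of _ "insert a X"])
  have "card F = card G + card K"
    using fin by (subst card_Un_disjoint[symmetric]) (auto simp: G_def K_def intro!: arg_cong[of _ _ card])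
  also have "card K = card H"
    unfolding H_def by (rule card_image[symmetric]) (auto simp: inj_on_def K_def)
  also have "card G + card H = card (G \<union> H) + card (G \<inter> H)"
    using fin by (intro card_Un_Int)
  also have "\<dots> \<le> card (?Sh A (G \<union> H)) + card (?Sh A (G \<inter> H))"
    using GA HA by (intro add_mono insert.IH) auto
  also have "card (?Sh A (G \<inter> H)) = card (insert a ` ?Sh A (G \<inter> H))"
    using insert.hyps(2) by (intro card_image[symmetric]) (auto simp: inj_on_def)
  \<comment> \<open>The two collections are disjoint, since only the members of the second contain
    \<open>a\<close>.\<close>
  also have "card (?Sh A (G \<union> H)) + \<dots> = card (?Sh A (G \<union> H) \<union> insert a ` ?Sh A (G \<inter> H))"
    using insert.hyps by (subst card_Un_disjoint) auto
  also have "\<dots> \<le> card (?Sh (insert a A) F)"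
  proof (rule card_mono)
    show "finite (?Sh (insert a A) F)" using insert.hyps(1) by simp
    have 1: "shatters F S" if S: "S \<subseteq> A" "shatters (G \<union> H) S" for S
      unfolding shatters_def
    proof
      fix B assume "B \<in> Pow S"
      then have "B \<subseteq> S" by simp
      with S(2) obtain X where X: "X \<in> G \<union> H" "X \<inter> S = B"
        by (rule shattersD)
      have "insert a X \<inter> S = B" using X(2) S(1) insert.hyps(2) by auto
      then show "B \<in> (\<lambda>X. X \<inter> S) ` F"
        using X by (auto simp: G_def H_iff)
    qed
    \<comment> \<open>Membership in both \<open>G\<close> and \<open>H\<close> puts \<open>X\<close>
      and \<open>insert a X\<close> into \<open>F\<close>, so \<open>a\<close> can be left out of
      the trace or included in it.\<close>
    have 2: "shatters F (insert a S)" if S: "S \<subseteq> A" "shatters (G \<inter> H) S" for S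
      unfolding shatters_def
    proof
      fix B assume B: "B \<in> Pow (insert a S)"
      then have "B - {a} \<subseteq> S" by auto
      with S(2) obtain X where X: "X \<in> G \<inter> H" "X \<inter> S = B - {a}"
        by (rule shattersD)
      have aS: "a \<notin> S" "a \<notin> X" using S(1) insert.hyps(2) X(1) by (auto simp: G_def)
      show "B \<in> (\<lambda>X. X \<inter> insert a S) ` F"
      proof (cases "a \<in> B")
        case True
        then have "B = insert a X \<inter> insert a S" using X(2) aS by auto
        then show ?thesis using X(1) by (auto simp: H_iff)
      next
        case False
        then have "B = X \<inter> insert a S" using X(2) aS by auto
        then show ?thesis using X(1) by (auto simp: G_def)
      qed
    qed
    show "?Sh A (G \<union> H) \<union> insert a ` ?Sh A (G \<inter> H) \<subseteq> ?Sh (insert a A) F"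
      using 1 2 by auto
  qed
  finally show ?case .
qed

text \<open>A set of size at most \<open>Suc d\<close> is a set of size at most \<open>d\<close>
  with at most one point of \<open>A\<close> adjoined, so each step costs a factor
  \<open>card A + 1\<close>; \<open>None\<close> stands for adjoining nothing.\<close>

lemma card_subsets_card_le:
  assumes "finite A"
  shows "card {S. S \<subseteq> A \<and> card S \<le> d} \<le> (card A + 1) ^ d"
proof (induction d)
  case 0
  have "{S. S \<subseteq> A \<and> card S \<le> 0} = {{}}"
    using assms by (auto dest: finite_subset)
  then show ?case by simp
next
  case (Suc d)
  let ?C = "{S. S \<subseteq> A \<and> card S \<le> d}"
  let ?g = "\<lambda>(S, u). case u of None \<Rightarrow> S | Some x \<Rightarrow> insert x S"
  let ?U = "insert None (Some ` A)"
  have "{S. S \<subseteq> A \<and> card S \<le> Suc d} \<subseteq> ?g ` (?C \<times> ?U)"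
  proof
    fix S assume S: "S \<in> {S. S \<subseteq> A \<and> card S \<le> Suc d}"
    show "S \<in> ?g ` (?C \<times> ?U)"
    proof (cases "card S \<le> d")
      case True
      then show ?thesis using S by (intro image_eqI[of _ _ "(S, None)"]) auto
    next
      case False
      with S have c: "card S = Suc d" by simp
      then obtain x where x: "x \<in> S" by fastforce
      then show ?thesis using S c
        by (intro image_eqI[of _ _ "(S - {x}, Some x)"]) auto
    qed
  qed
  then have "card {S. S \<subseteq> A \<and> card S \<le> Suc d} \<le> card (?g ` (?C \<times> ?U))"
    using assms by (intro card_mono) auto
  also have "\<dots> \<le> card (?C \<times> ?U)"
    using assms by (intro card_image_le) auto
  also have "\<dots> = card ?C * (card A + 1)"
    using assms by (simp add: card_cartesian_product card_image)
  also have "\<dots> \<le> (card A + 1) ^ d * (card A + 1)"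
    using Suc by (rule mult_right_mono) simp
  finally show ?case by (simp add: mult.commute)
qed

text \<open>Shattering passes to subsets, so a shattered set is a small shattered part outside
  \<open>C\<close> together with some subset of \<open>A \<inter> C\<close>. The two factors count
  these parts, and Pajor's inequality bounds \<open>card F\<close> by the number of shattered
  sets.\<close>

lemma card_le_if_shattered_parts_small:
  assumes "finite A" and "F \<subseteq> Pow A"
    and small: "\<And>S. S \<subseteq> A - C \<Longrightarrow> shatters F S \<Longrightarrow> card S \<le> d"
  shows "card F \<le> (card A + 1) ^ d * 2 ^ card (A \<inter> C)"
proof -
  let ?V = "{S. S \<subseteq> A - C \<and> card S \<le> d}"
  let ?h = "\<lambda>(S, U). S \<union> U"
  have "{S. S \<subseteq> A \<and> shatters F S} \<subseteq> ?h ` (?V \<times> Pow (A \<inter> C))"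
  proof
    fix S assume S: "S \<in> {S. S \<subseteq> A \<and> shatters F S}"
    have "shatters F (S - C)"
      unfolding shatters_def
    proof
      fix B assume "B \<in> Pow (S - C)"
      moreover from this have "B \<subseteq> S" by auto
      with S obtain X where "X \<in> F" "X \<inter> S = B" by (blast elim: shattersD)
      ultimately have "X \<inter> (S - C) = B" by blast
      with \<open>X \<in> F\<close> show "B \<in> (\<lambda>X. X \<inter> (S - C)) ` F" by blast
    qed
    then have "card (S - C) \<le> d" using S by (intro small) auto
    then show "S \<in> ?h ` (?V \<times> Pow (A \<inter> C))"
      using S by (intro image_eqI[of _ _ "(S - C, S \<inter> C)"]) auto
  qed
  then have "card {S. S \<subseteq> A \<and> shatters F S} \<le> card (?h ` (?V \<times> Pow (A \<inter> C)))"
    using assms(1) by (intro card_mono) auto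
  also have "\<dots> \<le> card (?V \<times> Pow (A \<inter> C))"
    using assms(1) by (intro card_image_le) auto
  also have "\<dots> = card ?V * 2 ^ card (A \<inter> C)"
    using assms(1) by (simp add: card_cartesian_product card_Pow del: Pow_Int_eq)
  also have "\<dots> \<le> (card (A - C) + 1) ^ d * 2 ^ card (A \<inter> C)"
    using assms(1) by (intro mult_right_mono card_subsets_card_le) auto
  also have "\<dots> \<le> (card A + 1) ^ d * 2 ^ card (A \<inter> C)"
    using assms(1) by (intro mult_right_mono power_mono add_mono card_mono) auto
  finally show ?thesis
    using card_le_card_shattered[OF assms(1,2)] by linarith
qed

section \<open>The margin condition\<close>

text \<open>Whenever \<open>f v\<close> is nonzero, the line through \<open>x\<close> in direction
  \<open>v\<close> meets the hyperplane, at distance at least \<open>\<Delta>\<close> from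
  \<open>x\<close>. This bounds \<open>f v\<close> by a multiple of \<open>norm v\<close>, hence the
  operator norm.\<close>

lemma infdist_hyperplane_times_norm_le:
  fixes f :: "'a::real_normed_vector \<Rightarrow>\<^sub>L real"
  assumes "0 \<le> \<Delta>" and "\<Delta> \<le> infdist x {u. blinfun_apply f u = b}"
  shows "\<Delta> * norm f \<le> \<bar>blinfun_apply f x - b\<bar>"
proof (cases "\<Delta> = 0")
  case False
  with assms have pos: "0 < \<Delta>" by simp
  have "norm f \<le> \<bar>blinfun_apply f x - b\<bar> / \<Delta>"
  proof (rule norm_blinfun_bound)
    show "0 \<le> \<bar>blinfun_apply f x - b\<bar> / \<Delta>" using pos by simp
    show "norm (blinfun_apply f v) \<le> \<bar>blinfun_apply f x - b\<bar> / \<Delta> * norm v" for v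
    proof (cases "blinfun_apply f v = 0")
      case nz: False
      define u where "u = x - ((blinfun_apply f x - b) / blinfun_apply f v) *\<^sub>R v"
      have "blinfun_apply f u = b"
        using nz by (simp add: u_def blinfun.diff_right blinfun.scaleR_right)
      then have "infdist x {u. blinfun_apply f u = b} \<le> dist x u"
        by (intro infdist_le) simp
      also have "dist x u = \<bar>blinfun_apply f x - b\<bar> / \<bar>blinfun_apply f v\<bar> * norm v"
        by (simp add: u_def dist_norm)
      finally have "\<Delta> \<le> \<bar>blinfun_apply f x - b\<bar> / \<bar>blinfun_apply f v\<bar> * norm v"
        using assms(2) by linarith
      then show ?thesis using nz pos by (simp add: field_simps)
    qed (use pos in simp)
  qed
  then show ?thesis using pos by (simp add: field_simps)
qed simp

text \<open>An error requires \<open>x\<close> to lie outside the margin on the side opposite to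
  \<open>y\<close>, which fixes the sign of \<open>f x - b\<close> and explains the minus.\<close>

lemma predicts_incorrectly_gap_tolerant_classifier:
  fixes f :: "'a::real_normed_vector \<Rightarrow>\<^sub>L real"
  assumes "predicts_incorrectly (gap_tolerant_classifier \<Delta> f b) x y"
    and "y \<in> {-1, 1}" and "0 \<le> \<Delta>"
  shows "\<Delta> * norm f \<le> - of_int y * (blinfun_apply f x - b)"
proof -
  have "\<not> infdist x {u. blinfun_apply f u = b} < \<Delta>"
    using assms(1) unfolding predicts_incorrectly_def gap_tolerant_classifier_def by auto
  then have "\<Delta> * norm f \<le> \<bar>blinfun_apply f x - b\<bar>"
    using assms(3) by (intro infdist_hyperplane_times_norm_le) auto
  then show ?thesis
    using assms(1,2) unfolding predicts_incorrectly_def gap_tolerant_classifier_def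
    by (auto split: if_splits)
qed

section \<open>Shattered sets in a ball and the type inequality\<close>

text \<open>Convexity of the power function at the midpoint. It is applied to positive arguments, so
  a zero argument is treated separately.\<close>

lemma powr_add_le:
  fixes a b p :: real
  assumes "1 \<le> p" and "0 \<le> a" and "0 \<le> b"
  shows "(a + b) powr p \<le> 2 powr (p - 1) * (a powr p + b powr p)"
proof (cases "a = 0 \<or> b = 0")
  case True
  have "1 * (a + b) powr p \<le> 2 powr (p - 1) * (a + b) powr p"
    using assms(1) by (intro mult_right_mono ge_one_powr_ge_zero) auto
  then show ?thesis using True by auto
next
  case False
  have "((1 - 1/2) *\<^sub>R a + (1/2) *\<^sub>R b) powr p \<le> (1 - 1/2) * a powr p + (1/2) * b powr p"
    using False assms by (intro convex_onD[OF powr_convex]) auto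
  then have "((a + b) / 2) powr p \<le> (a powr p + b powr p) / 2"
    by (simp add: add_divide_distrib)
  then have "(a + b) powr p / 2 powr p \<le> (a powr p + b powr p) / 2"
    using assms by (simp add: powr_divide)
  then show ?thesis by (simp add: powr_diff field_simps)
qed

text \<open>Besides the shattered points, the type inequality is applied to copies of a single vector,
  which controls the contribution of the offset \<open>b\<close>.\<close>

lemma card_shattered_le:
  fixes S :: "'a::real_normed_vector set"
  assumes T: "T \<in> type_bounds TYPE('a) p" and p: "1 < p" and "0 < \<Delta>"
    and "finite S" and S: "S \<subseteq> cball 0 R" and two: "2 \<le> card S"
    and shat: "\<And>y. y \<in> S \<rightarrow>\<^sub>E {-1, 1} \<Longrightarrow>
      \<exists>h \<in> gap_tolerant_classifiers \<Delta>. \<forall>x\<in>S. predicts_incorrectly h x (y x)"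
  shows "real (card S) \<le> (2 * T * R / \<Delta>) powr (p / (p - 1))"
proof -
  define n where "n = card S"
  obtain x where x: "bij_betw x {..<n} S"
    using ex_bij_betw_nat_finite[OF \<open>finite S\<close>] by (auto simp: n_def atLeast0LessThan)
  have xS: "x i \<in> S" if "i < n" for i
    using x that by (auto dest: bij_betwE)
  have xR: "norm (x i) \<le> R" if "i < n" for i
    using xS[OF that] S by auto
  have R: "0 \<le> R" using xR[of 0] two norm_ge_zero[of "x 0"] unfolding n_def by linarith
  have T0: "0 \<le> T" using T by (simp add: type_bounds_def)
  \<comment> \<open>Every sign pattern is realized with functional margin: the labels are the
    opposite signs, because the classifier has to err on them.\<close>
  have cl: "\<exists>f b. f \<noteq> 0 \<and> (\<forall>i<n. \<Delta> * norm f \<le> \<epsilon> i * (blinfun_apply f (x i) - b))"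
    if \<epsilon>: "\<And>i. i < n \<Longrightarrow> \<epsilon> i \<in> {-1, 1 :: real}" for \<epsilon>
  proof -
    define y where "y = (\<lambda>u\<in>S. if \<epsilon> (the_inv_into {..<n} x u) = 1 then -1 else (1::int))"
    have "y \<in> S \<rightarrow>\<^sub>E {-1, 1}" by (auto simp: y_def)
    from shat[OF this] obtain f b where f: "f \<noteq> 0"
      and pr: "\<forall>u\<in>S. predicts_incorrectly (gap_tolerant_classifier \<Delta> f b) u (y u)"
      by (auto simp: gap_tolerant_classifiers_def)
    have "\<Delta> * norm f \<le> \<epsilon> i * (blinfun_apply f (x i) - b)" if i: "i < n" for i
    proof -
      have "the_inv_into {..<n} x (x i) = i"
        using x i by (intro the_inv_into_f_f) (auto simp: bij_betw_def)
      then have y: "- of_int (y (x i)) = \<epsilon> i" "y (x i) \<in> {-1, 1}"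
        using \<epsilon>[OF i] xS[OF i] by (auto simp: y_def)
      show ?thesis
        using predicts_incorrectly_gap_tolerant_classifier[OF pr[rule_format, OF xS[OF i]] y(2)]
          \<open>0 < \<Delta>\<close> y(1) by simp
    qed
    with f show ?thesis by blast
  qed
  have fx: "\<bar>blinfun_apply f (x i)\<bar> \<le> norm f * R" if "i < n" for f i
    using order_trans[OF norm_blinfun[of f "x i"] mult_left_mono[OF xR[OF that] norm_ge_zero]]
    by simp
  \<comment> \<open>Adding the conditions at two points of opposite sign eliminates
    \<open>b\<close>. The result serves the constant sign patterns in \<open>key\<close>.\<close>
  have \<Delta>R: "\<Delta> \<le> R"
  proof -
    have "\<exists>f b. f \<noteq> 0 \<and>
        (\<forall>i<n. \<Delta> * norm f \<le> (if i = 0 then 1 else -1) * (blinfun_apply f (x i) - b))"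
      by (rule cl) simp
    then obtain f b where f: "f \<noteq> 0"
      "\<forall>i<n. \<Delta> * norm f \<le> (if i = 0 then 1 else -1) * (blinfun_apply f (x i) - b)"
      by blast
    have "\<Delta> * norm f \<le> blinfun_apply f (x 0) - b" "\<Delta> * norm f \<le> b - blinfun_apply f (x 1)"
      using f(2)[rule_format, of 0] f(2)[rule_format, of 1] two by (auto simp: n_def)
    moreover have "\<bar>blinfun_apply f (x 0)\<bar> \<le> norm f * R" "\<bar>blinfun_apply f (x 1)\<bar> \<le> norm f * R"
      using two by (auto intro!: fx simp: n_def)
    ultimately have "\<Delta> * norm f \<le> R * norm f" by (simp add: mult.commute abs_le_iff)
    then show ?thesis using f(1) by simp
  qed
  \<comment> \<open>Summing the margin inequalities over \<open>i\<close> leaves a term in the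
    offset \<open>b\<close>. If the signs are constant, \<open>b\<close> is not controlled, but then
    the sum of signs has absolute value \<open>n\<close> and \<open>\<Delta>R\<close>
    suffices.\<close>
  have key: "real n * \<Delta> \<le> norm (\<Sum>i<n. \<epsilon> i *\<^sub>R x i) + R * \<bar>\<Sum>i<n. \<epsilon> i\<bar>"
    if \<epsilon>: "\<And>i. i < n \<Longrightarrow> \<epsilon> i \<in> {-1, 1 :: real}" for \<epsilon>
  proof (cases "\<exists>c\<in>{-1, 1}. \<forall>i<n. \<epsilon> i = c")
    case True
    then obtain c where c: "c \<in> {-1, 1}" "\<And>i. i < n \<Longrightarrow> \<epsilon> i = c" by auto
    have "(\<Sum>i<n. \<epsilon> i) = real n * c" using c(2) by simp
    then have "\<bar>\<Sum>i<n. \<epsilon> i\<bar> = real n" using c(1) by auto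
    moreover have "real n * \<Delta> \<le> real n * R" using \<Delta>R by (intro mult_left_mono) auto
    ultimately show ?thesis using norm_ge_zero[of "\<Sum>i<n. \<epsilon> i *\<^sub>R x i"]
      by (simp only: mult.commute[of R])
  next
    case False
    then obtain i j where ij: "i < n" "\<epsilon> i \<noteq> -1" "j < n" "\<epsilon> j \<noteq> 1" by auto
    with \<epsilon> have e: "\<epsilon> i = 1" "\<epsilon> j = -1" by blast+
    obtain f b where f: "f \<noteq> 0"
      and fb: "\<And>i. i < n \<Longrightarrow> \<Delta> * norm f \<le> \<epsilon> i * (blinfun_apply f (x i) - b)"
      using cl[of \<epsilon>] \<epsilon> by blast
    have "0 \<le> \<Delta> * norm f" using \<open>0 < \<Delta>\<close> by simp
    \<comment> \<open>With a point of the ball on each side of the hyperplane, \<open>b\<close> lies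
      between two values of \<open>f\<close> on the ball.\<close>
    then have b: "\<bar>b\<bar> \<le> norm f * R"
      using fb[OF ij(1)] fb[OF ij(3)] fx[OF ij(1), of f] fx[OF ij(3), of f] e by auto
    have "real n * (\<Delta> * norm f) = (\<Sum>i<n. \<Delta> * norm f)" by simp
    also have "\<dots> \<le> (\<Sum>i<n. \<epsilon> i * (blinfun_apply f (x i) - b))"
      using fb by (intro sum_mono) auto
    also have "\<dots> = blinfun_apply f (\<Sum>i<n. \<epsilon> i *\<^sub>R x i) - b * (\<Sum>i<n. \<epsilon> i)"
      by (simp add: blinfun.sum_right blinfun.scaleR_right algebra_simps sum_subtractf sum_distrib_left)
    also have "\<dots> \<le> norm f * norm (\<Sum>i<n. \<epsilon> i *\<^sub>R x i) + \<bar>b\<bar> * \<bar>\<Sum>i<n. \<epsilon> i\<bar>"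
      using norm_blinfun[of f "\<Sum>i<n. \<epsilon> i *\<^sub>R x i"] abs_ge_minus_self[of "b * (\<Sum>i<n. \<epsilon> i)"]
      unfolding real_norm_def abs_mult by linarith
    also have "\<bar>b\<bar> * \<bar>\<Sum>i<n. \<epsilon> i\<bar> \<le> norm f * R * \<bar>\<Sum>i<n. \<epsilon> i\<bar>"
      using b by (intro mult_right_mono) auto
    finally have "norm f * (real n * \<Delta>) \<le> norm f * (norm (\<Sum>i<n. \<epsilon> i *\<^sub>R x i) + R * \<bar>\<Sum>i<n. \<epsilon> i\<bar>)"
      by (simp add: algebra_simps)
    then show ?thesis using f by simp
  qed

  let ?E = "measure_pmf.expectation (rademacher_signs n)"
  have set: "set_pmf (rademacher_signs n) \<subseteq> PiE_dflt {..<n} 0 (\<lambda>_. {-1, 1})"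
    unfolding rademacher_signs_def by (simp add: set_Pi_pmf comp_def)
  have int: "integrable (measure_pmf (rademacher_signs n)) g" for g :: "_ \<Rightarrow> real"
    using set by (intro integrable_measure_pmf_finite) (auto intro: finite_subset)
  \<comment> \<open>Copies of one nonzero vector transfer the type inequality to the scalar sum of
    signs; two distinct points ensure that such a vector exists.\<close>
  obtain v :: 'a where v: "v \<noteq> 0"
  proof -
    have "x 0 \<noteq> x 1" using inj_onD[OF bij_betw_imp_inj_on[OF x], of 0 1] two by (auto simp: n_def)
    then show ?thesis using that by metis
  qed
  have Tx: "?E (\<lambda>\<epsilon>. norm (\<Sum>i<n. \<epsilon> i *\<^sub>R w i) powr p) \<le> T powr p * (\<Sum>i<n. norm (w i) powr p)"
    for w :: "nat \<Rightarrow> 'a"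
    using T by (simp add: type_bounds_def)
  have E1: "?E (\<lambda>\<epsilon>. norm (\<Sum>i<n. \<epsilon> i *\<^sub>R x i) powr p) \<le> T powr p * (real n * R powr p)"
  proof -
    have "(\<Sum>i<n. norm (x i) powr p) \<le> (\<Sum>i<n. R powr p)"
      using xR p by (intro sum_mono powr_mono2) auto
    then show ?thesis
      using Tx[of x] mult_left_mono[of _ "real n * R powr p" "T powr p"] by fastforce
  qed
  have E2: "?E (\<lambda>\<epsilon>. \<bar>\<Sum>i<n. \<epsilon> i\<bar> powr p) \<le> T powr p * real n"
  proof -
    have "?E (\<lambda>\<epsilon>. \<bar>\<Sum>i<n. \<epsilon> i\<bar> powr p) * norm v powr p
        \<le> (T powr p * real n) * norm v powr p"
      using Tx[of "\<lambda>_. v"]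
      by (simp add: scaleR_sum_left[symmetric] powr_mult algebra_simps)
    then show ?thesis using v by simp
  qed
  \<comment> \<open>The bound \<open>key\<close> holds for every sign pattern, so its
    \<open>p\<close>-th power may be averaged. Both terms get the same bound, which turns
    \<open>2 powr (p - 1)\<close> into \<open>2 powr p\<close>.\<close>
  have "(real n * \<Delta>) powr p = ?E (\<lambda>_. (real n * \<Delta>) powr p)" by simp
  also have "\<dots> \<le> ?E (\<lambda>\<epsilon>. 2 powr (p - 1) *
      (norm (\<Sum>i<n. \<epsilon> i *\<^sub>R x i) powr p + R powr p * \<bar>\<Sum>i<n. \<epsilon> i\<bar> powr p))"
  proof (rule integral_mono_AE[OF int int], rule AE_pmfI)
    fix \<epsilon> assume "\<epsilon> \<in> set_pmf (rademacher_signs n)"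
    with set have "\<epsilon> \<in> PiE_dflt {..<n} 0 (\<lambda>_. {-1, 1})" by blast
    then have \<epsilon>: "\<epsilon> i \<in> {-1, 1}" if "i < n" for i
      using that by (auto simp: PiE_dflt_def)
    have "(real n * \<Delta>) powr p \<le> (norm (\<Sum>i<n. \<epsilon> i *\<^sub>R x i) + R * \<bar>\<Sum>i<n. \<epsilon> i\<bar>) powr p"
      using key[OF \<epsilon>] p \<open>0 < \<Delta>\<close> by (intro powr_mono2) auto
    also have "\<dots> \<le> 2 powr (p - 1) *
      (norm (\<Sum>i<n. \<epsilon> i *\<^sub>R x i) powr p + (R * \<bar>\<Sum>i<n. \<epsilon> i\<bar>) powr p)"
      using p R by (intro powr_add_le) auto
    finally show "(real n * \<Delta>) powr p \<le> 2 powr (p - 1) *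
      (norm (\<Sum>i<n. \<epsilon> i *\<^sub>R x i) powr p + R powr p * \<bar>\<Sum>i<n. \<epsilon> i\<bar> powr p)"
      using R by (simp add: powr_mult)
  qed
  also have "\<dots> = 2 powr (p - 1) * (?E (\<lambda>\<epsilon>. norm (\<Sum>i<n. \<epsilon> i *\<^sub>R x i) powr p)
      + R powr p * ?E (\<lambda>\<epsilon>. \<bar>\<Sum>i<n. \<epsilon> i\<bar> powr p))"
    using int by simp
  also have "\<dots> \<le> 2 powr (p - 1) * (T powr p * (real n * R powr p) + R powr p * (T powr p * real n))"
    using E1 E2 by (intro mult_left_mono add_mono) auto
  also have "\<dots> = 2 powr p * T powr p * R powr p * real n"
    by (simp add: powr_diff)
  finally have le: "(real n * \<Delta>) powr p \<le> 2 powr p * T powr p * R powr p * real n" .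
  \<comment> \<open>Cancelling one factor \<open>n\<close> leaves \<open>n powr (p - 1)\<close> on
    the left; a root of order \<open>p - 1\<close> then isolates \<open>n\<close>.\<close>
  have n: "0 < real n" using two by (simp add: n_def)
  have "real n powr (p - 1) * real n = real n powr p"
    using n by (simp add: powr_diff)
  then have "real n powr (p - 1) * real n * \<Delta> powr p \<le> 2 powr p * T powr p * R powr p * real n"
    using le n \<open>0 < \<Delta>\<close> by (simp add: powr_mult)
  then have "real n powr (p - 1) \<le> 2 powr p * T powr p * R powr p / \<Delta> powr p"
    using n \<open>0 < \<Delta>\<close> by (simp add: field_simps)
  also have "\<dots> = (2 * T * R / \<Delta>) powr p"
    using T0 R \<open>0 < \<Delta>\<close> by (simp add: powr_mult powr_divide)
  finally have "(real n powr (p - 1)) powr (1 / (p - 1)) \<le> ((2 * T * R / \<Delta>) powr p) powr (1 / (p - 1))"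
    using p by (intro powr_mono2) auto
  then show ?thesis using p n by (simp add: powr_powr n_def)
qed

section \<open>Counting the labelings of a finite set\<close>

text \<open>A labeling is encoded by the set of points labeled \<open>1\<close>; shattering by these
  sets means that all labelings of the shattered set are realized. Since the type argument needs two
  points, \<open>1 \<le> d\<close> takes care of smaller sets.\<close>

lemma num_labelings_le:
  fixes A :: "'a::real_normed_vector set"
  assumes T: "T \<in> type_bounds TYPE('a) p" and p: "1 < p" and "0 < \<Delta>" and "finite A"
    and d: "1 \<le> d" and d': "\<And>n. real n \<le> (2 * T * R / \<Delta>) powr (p / (p - 1)) \<Longrightarrow> n \<le> d"
  shows "num_labelings (gap_tolerant_classifiers \<Delta>) A
    \<le> (card A + 1) ^ d * 2 ^ card (A \<inter> {x. R < norm x})"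
proof -
  define Y where "Y = {y \<in> A \<rightarrow>\<^sub>E {-1, 1}. \<exists>h\<in>gap_tolerant_classifiers \<Delta>.
    \<forall>x\<in>A. predicts_incorrectly h x (y x)}"
  define F where "F = (\<lambda>y. {x\<in>A. y x = 1}) ` Y"
  have Y: "y \<in> A \<rightarrow>\<^sub>E {-1, 1}" if "y \<in> Y" for y
    using that by (simp add: Y_def)
  have inj: "inj_on (\<lambda>y. {x\<in>A. y x = 1}) Y"
  proof (rule inj_onI)
    fix y y' assume y: "y \<in> Y" "y' \<in> Y" and eq: "{x\<in>A. y x = 1} = {x\<in>A. y' x = 1}"
    show "y = y'"
    proof (rule PiE_ext[OF Y[OF y(1)] Y[OF y(2)]])
      fix x assume x: "x \<in> A"
      then have "y x = 1 \<longleftrightarrow> y' x = 1" using eq by blast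
      then show "y x = y' x" using PiE_mem[OF Y[OF y(1)] x] PiE_mem[OF Y[OF y(2)] x] by auto
    qed
  qed
  have "card F \<le> (card A + 1) ^ d * 2 ^ card (A \<inter> {x. R < norm x})"
  proof (rule card_le_if_shattered_parts_small)
    show "finite A" by fact
    show "F \<subseteq> Pow A" by (auto simp: F_def)
    fix S assume S: "S \<subseteq> A - {x. R < norm x}" and sh: "shatters F S"
    show "card S \<le> d"
    proof (cases "2 \<le> card S")
      case True
      have "real (card S) \<le> (2 * T * R / \<Delta>) powr (p / (p - 1))"
      proof (rule card_shattered_le[OF T p \<open>0 < \<Delta>\<close> _ _ True])
        show "finite S" using S \<open>finite A\<close> by (auto intro: finite_subset)
        show "S \<subseteq> cball 0 R" using S by auto
        fix y :: "'a \<Rightarrow> int" assume y: "y \<in> S \<rightarrow>\<^sub>E {-1, 1}"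
        obtain X where X: "X \<in> F" "X \<inter> S = {x \<in> S. y x = 1}"
          by (rule shattersD[OF sh, of "{x \<in> S. y x = 1}"]) auto
        then obtain y' where y': "y' \<in> Y" "X = {x\<in>A. y' x = 1}" by (auto simp: F_def)
        have "y' x = y x" if x: "x \<in> S" for x
        proof -
          have xA: "x \<in> A" using x S by auto
          have "y' x = 1 \<longleftrightarrow> y x = 1" using X(2) y'(2) x xA by blast
          then show ?thesis using PiE_mem[OF y x] PiE_mem[OF Y[OF y'(1)] xA] by auto
        qed
        moreover obtain h where "h \<in> gap_tolerant_classifiers \<Delta>"
          "\<forall>x\<in>A. predicts_incorrectly h x (y' x)" using y'(1) by (auto simp: Y_def)
        ultimately show "\<exists>h\<in>gap_tolerant_classifiers \<Delta>. \<forall>x\<in>S. predicts_incorrectly h x (y x)"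
          using S by (intro bexI[of _ h]) (metis DiffD1 subsetD)
      qed
      then show ?thesis by (rule d')
    qed (use d in simp)
  qed
  moreover have "card F = card Y" unfolding F_def by (rule card_image[OF inj])
  ultimately show ?thesis by (simp add: num_labelings_def Y_def)
qed

section \<open>Annealed entropy\<close>

text \<open>The radius \<open>R\<close> is left free so that it can be optimized afterwards. The
  \<open>+ 1\<close> pays for rounding the shattering bound to a natural number that is at least
  one.\<close>

lemma annealed_entropy_le:
  fixes P :: "'a::banach measure"
  assumes "prob_space P" and sets: "sets P = sets borel"
    and T: "T \<in> type_bounds TYPE('a) p" and p: "1 < p" and "0 < \<Delta>" and "0 < \<gamma>"
    and int: "integrable P (\<lambda>x. norm x powr \<gamma>)"
    and r: "0 \<le> r" "(\<integral>x. norm x powr \<gamma> \<partial>P) = r powr \<gamma>"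
    and R: "0 < R"
  shows "annealed_entropy (gap_tolerant_classifiers \<Delta> :: ('a \<Rightarrow> int option) set) P l
    \<le> real l * (r / R) powr \<gamma> + ((2 * T * R / \<Delta>) powr (p / (p - 1)) + 1) * ln (real l + 1)"
proof -
  interpret P: prob_space P by fact
  interpret PP: product_sigma_finite "\<lambda>_. P" ..
  define D where "D = (2 * T * R / \<Delta>) powr (p / (p - 1))"
  \<comment> \<open>This value is at least 1 and at least every natural number below
    \<open>D\<close>, yet at most \<open>D + 1\<close>.\<close>
  define d where "d = nat \<lfloor>D + 1\<rfloor>"
  have D0: "0 \<le> D" by (simp add: D_def)
  have d: "1 \<le> d" using D0 unfolding d_def by linarith
  have dD: "real d \<le> D + 1" using D0 unfolding d_def by linarith
  have d': "n \<le> d" if "real n \<le> D" for n using that unfolding d_def by linarith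
  define out where "out = {x :: 'a. R < norm x}"
  have space: "space P = UNIV" using sets_eq_imp_space_eq[OF sets] by simp
  have outm [measurable]: "out \<in> sets P" unfolding sets out_def by measurable
  \<comment> \<open>The weight is 2 outside the ball and 1 inside, so its product over the sample is
    the power of two in the counting bound, and it factors over the coordinates.\<close>
  define w where "w = (\<lambda>x. 1 + indicator out x :: ennreal)"
  have wm [measurable]: "w \<in> borel_measurable P" unfolding w_def by measurable
  let ?M = "\<Pi>\<^sub>M i\<in>{..<l}. P"
  let ?\<Lambda> = "gap_tolerant_classifiers \<Delta> :: ('a \<Rightarrow> int option) set"
  let ?N = "\<lambda>z. ennreal (real (num_labelings ?\<Lambda> (z ` {..<l})))"
  let ?G = "\<lambda>z. ennreal (real ((l + 1) ^ d)) * (\<Prod>i<l. w (z i))"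
  have NG: "?N z \<le> ?G z" for z :: "nat \<Rightarrow> 'a"
  proof -
    let ?I = "{i \<in> {..<l}. z i \<in> out}"
    have "num_labelings ?\<Lambda> (z ` {..<l})
        \<le> (card (z ` {..<l}) + 1) ^ d * 2 ^ card (z ` {..<l} \<inter> out)"
      unfolding out_def
      by (rule num_labelings_le[OF T p \<open>0 < \<Delta>\<close>]) (use d d' in \<open>auto simp: D_def\<close>)
    also have "\<dots> \<le> (l + 1) ^ d * 2 ^ card ?I"
    proof (intro mult_mono power_mono power_increasing)
      show "card (z ` {..<l}) + 1 \<le> l + 1" using card_image_le[of "{..<l}" z] by simp
      \<comment> \<open>Sample points may coincide, so there are at most as many outlying points as
        outlying indices.\<close>
      have "z ` {..<l} \<inter> out = z ` ?I" by auto
      then show "card (z ` {..<l} \<inter> out) \<le> card ?I" by (simp add: card_image_le)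
    qed auto
    finally have "?N z \<le> ennreal (real ((l + 1) ^ d * 2 ^ card ?I))"
      by (intro ennreal_leI) (simp only: of_nat_le_iff)
    also have "\<dots> = ennreal (real ((l + 1) ^ d)) * ennreal (2 ^ card ?I)"
      by (simp add: ennreal_mult)
    also have "ennreal (2 ^ card ?I) = (\<Prod>i\<in>?I. w (z i))"
      by (simp add: w_def ennreal_power[symmetric])
    also have "\<dots> = (\<Prod>i<l. w (z i))"
      by (rule prod.mono_neutral_left) (auto simp: w_def)
    finally show ?thesis .
  qed
  let ?q = "measure P out"
  \<comment> \<open>Markov's inequality for \<open>norm x powr \<gamma>\<close>.\<close>
  have "?q * R powr \<gamma> \<le> r powr \<gamma>"
  proof -
    have "?q * R powr \<gamma> = (\<integral>x. indicator out x * R powr \<gamma> \<partial>P)"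
      using space by simp
    also have "\<dots> \<le> (\<integral>x. norm x powr \<gamma> \<partial>P)"
    proof (rule integral_mono[OF _ int])
      show "integrable P (\<lambda>x. indicator out x * R powr \<gamma>)"
        by (intro integrable_mult_left integrable_real_indicator) (auto simp: P.emeasure_eq_measure)
      show "indicator out x * R powr \<gamma> \<le> norm x powr \<gamma>" for x
        using R \<open>0 < \<gamma>\<close> by (auto simp: indicator_def out_def intro!: powr_mono2)
    qed
    finally show ?thesis using r by simp
  qed
  then have q: "?q \<le> (r / R) powr \<gamma>"
    using R r by (simp add: powr_divide field_simps)
  \<comment> \<open>The majorant \<open>?G\<close> is measurable, hence admissible in the infimum
    that defines the outer expectation.\<close>
  have "outer_expectation ?M ?N \<le> (\<integral>\<^sup>+ z. ?G z \<partial>?M)"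
    unfolding outer_expectation_def by (rule INF_lower) (use NG in auto)
  also have "\<dots> = ennreal (real ((l + 1) ^ d)) * (\<integral>\<^sup>+ z. (\<Prod>i<l. w (z i)) \<partial>?M)"
    by (rule nn_integral_cmult) measurable
  also have "(\<integral>\<^sup>+ z. (\<Prod>i<l. w (z i)) \<partial>?M) = (\<Prod>i<l. \<integral>\<^sup>+ x. w x \<partial>P)"
    by (rule PP.product_nn_integral_prod) auto
  also have "(\<integral>\<^sup>+ x. w x \<partial>P) = ennreal (1 + ?q)"
    unfolding w_def by (subst nn_integral_add) (auto simp: P.emeasure_eq_measure P.prob_space)
  also have "ennreal (real ((l + 1) ^ d)) * (\<Prod>i<l. ennreal (1 + ?q))
      = ennreal ((real l + 1) ^ d * (1 + ?q) ^ l)"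
    by (simp add: ennreal_power ennreal_mult add.commute del: ennreal_plus)
  finally have E: "enn2real (outer_expectation ?M ?N) \<le> (real l + 1) ^ d * (1 + ?q) ^ l"
    by (rule enn2real_leI[rotated]) auto
  have L0: "0 \<le> ln (real l + 1)" by simp
  show ?thesis
  \<comment> \<open>A vanishing expectation has logarithm 0 by convention, and the right-hand side
    is nonnegative.\<close>
  proof (cases "enn2real (outer_expectation ?M ?N) = 0")
    case True
    have "0 \<le> real l * (r / R) powr \<gamma> + (D + 1) * ln (real l + 1)"
      using D0 L0 by (intro add_nonneg_nonneg mult_nonneg_nonneg) auto
    then show ?thesis using True by (simp add: annealed_entropy_def D_def)
  next
    case False
    then have "0 < enn2real (outer_expectation ?M ?N)"
      by (simp add: less_le)
    then have "ln (enn2real (outer_expectation ?M ?N)) \<le> ln ((real l + 1) ^ d * (1 + ?q) ^ l)"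
      using E by (intro ln_mono) auto
    also have "\<dots> = real d * ln (real l + 1) + real l * ln (1 + ?q)"
      using measure_nonneg[of P out] by (subst ln_mult_pos) (auto simp: ln_realpow intro!: zero_less_power add_pos_nonneg)
    also have "\<dots> \<le> (D + 1) * ln (real l + 1) + real l * (r / R) powr \<gamma>"
    proof (intro add_mono mult_mono mult_left_mono dD L0)
      have "ln (1 + ?q) \<le> ?q" by (rule ln_add_one_self_le_self) simp
      then show "ln (1 + ?q) \<le> (r / R) powr \<gamma>" using q by linarith
    qed (use D0 in auto)
    finally show ?thesis by (simp add: annealed_entropy_def D_def add.commute)
  qed
qed

section \<open>Minimization over the radius\<close>

theorem theorem7:
  fixes P :: "'a::banach measure"
    and p T \<gamma> \<Delta> r \<eta> :: real
    and l :: nat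
  assumes "prob_space P" and "sets P = sets borel"
    and "1 < p" and "p \<le> 2"
    and "has_type TYPE('a) p" and "T = type_constant TYPE('a) p"
    and "0 < \<gamma>" and "0 < \<Delta>"
    and "\<eta> = p / (p + \<gamma> * (p - 1))"
    and "integrable P (\<lambda>x. norm x powr \<gamma>)"
    and "0 \<le> r" and "(\<integral>x. norm x powr \<gamma> \<partial>P) = r powr \<gamma>"
    and "1 \<le> l"
  shows "annealed_entropy (gap_tolerant_classifiers \<Delta> :: ('a \<Rightarrow> int option) set) P l
    \<le> (\<eta> powr (- \<eta>) * (1 - \<eta>) powr (- 1 + \<eta>)
          * (real l / ln (real l + 1) * (3 * T * r / \<Delta>) powr \<gamma>) powr \<eta> + 64)
        * ln (real l + 1)"
proof -
  have T: "T \<in> type_bounds TYPE('a) p"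
    using type_constant_least(1)[of p "TYPE('a)"] assms(3,5,6) by simp
  then have T0: "0 \<le> T" by (simp add: type_bounds_def)
  define L where "L = ln (real l + 1)"
  have L: "0 < L" using \<open>1 \<le> l\<close> by (simp add: L_def)
  note bd = annealed_entropy_le[OF assms(1,2) T assms(3,8,7,10,11,12), where l = l, folded L_def]
  let ?H = "annealed_entropy (gap_tolerant_classifiers \<Delta> :: ('a \<Rightarrow> int option) set) P l"
  let ?B = "\<eta> powr (- \<eta>) * (1 - \<eta>) powr (- 1 + \<eta>)
          * (real l / L * (3 * T * r / \<Delta>) powr \<gamma>) powr \<eta>"
  show ?thesis
  proof (cases "T = 0 \<or> r = 0")
    case True
    \<comment> \<open>The minimizing radius degenerates here. For \<open>T = 0\<close> the
      shattering term vanishes, and \<open>R\<close> is taken so large that the tail term is at most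
      \<open>L\<close>; for \<open>r = 0\<close> the tail vanishes and \<open>R\<close> makes the
      shattering term equal to \<open>L\<close>.\<close>
    define R where "R = (if T = 0 then (r + 1) * (real l / L + 1) powr (1 / \<gamma>) else \<Delta> / (2 * T))"
    have R: "0 < R" using T0 \<open>0 < \<Delta>\<close> \<open>0 \<le> r\<close> L
      by (auto simp: R_def less_le add_nonneg_eq_0_iff intro!: mult_pos_pos)
    have "real l * (r / R) powr \<gamma> + (2 * T * R / \<Delta>) powr (p / (p - 1)) * L \<le> L"
    proof (cases "T = 0")
      case True
      have "real l * (r / R) powr \<gamma> = real l * ((r / (r + 1)) powr \<gamma> / (real l / L + 1))"
        using True \<open>0 \<le> r\<close> \<open>0 < \<gamma>\<close> L
        by (simp add: R_def powr_divide powr_mult powr_powr)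
      also have "(r / (r + 1)) powr \<gamma> \<le> 1"
        using \<open>0 \<le> r\<close> \<open>0 < \<gamma>\<close> by (intro powr_le1) auto
      then have "real l * ((r / (r + 1)) powr \<gamma> / (real l / L + 1)) \<le> real l * (1 / (real l / L + 1))"
        using L by (intro mult_left_mono divide_right_mono) auto
      also have "\<dots> \<le> L" using L by (simp add: field_simps add_pos_nonneg)
      finally show ?thesis using True \<open>1 < p\<close> by simp
    next
      case False
      with \<open>T = 0 \<or> r = 0\<close> T0 show ?thesis using \<open>0 < \<Delta>\<close> by (simp add: R_def)
    qed
    then have "?H \<le> 2 * L" using bd[OF R] by (simp add: algebra_simps)
    also have "\<dots> \<le> (?B + 64) * L" using L by (intro mult_right_mono) auto
    finally show ?thesis by (simp add: L_def)
  next
    case False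
    then have T1: "0 < T" and r: "0 < r" using T0 \<open>0 \<le> r\<close> by auto
    \<comment> \<open>This is \<open>\<gamma>\<close> divided by the conjugate exponent of
      \<open>p\<close>: the tail term decays like \<open>s powr (- g)\<close> when the shattering
      term is measured by \<open>s\<close>.\<close>
    define g where "g = \<gamma> * (p - 1) / p"
    have g: "0 < g" using assms(3,7) by (simp add: g_def)
    have \<eta>: "\<eta> = 1 / (1 + g)" using assms(3,9) by (simp add: g_def field_simps)
    have \<eta>01: "0 < \<eta>" "\<eta> < 1" using g by (auto simp: \<eta>)
    have g\<eta>: "g = (1 - \<eta>) / \<eta>" using g by (simp add: \<eta> field_simps)
    \<comment> \<open>The 3 is that of the claim; the shattering bound has 2, so monotonicity closes
      the gap.\<close>
    define c where "c = 3 * T / \<Delta>"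
    have c: "0 < c" using T1 \<open>0 < \<Delta>\<close> by (simp add: c_def)
    define X where "X = real l / L * (c * r) powr \<gamma>"
    have X: "0 < X" using L r c \<open>1 \<le> l\<close> by (simp add: X_def)
    \<comment> \<open>the minimizer of \<open>s \<mapsto> X * s powr (- g) + s\<close>\<close>
    define s where "s = (g * X) powr \<eta>"
    have s: "0 < s" using g X by (simp add: s_def)
    \<comment> \<open>Chosen so that \<open>(c * R) powr (p / (p - 1))\<close> equals
      \<open>s\<close>.\<close>
    define R where "R = s powr ((p - 1) / p) / c"
    have R: "0 < R" using s c by (simp add: R_def)
    have cR: "c * R = s powr ((p - 1) / p)" using c by (simp add: R_def)
    have "(2 * T * R / \<Delta>) powr (p / (p - 1)) \<le> (c * R) powr (p / (p - 1))"
      using T1 R \<open>0 < \<Delta>\<close> \<open>1 < p\<close> by (intro powr_mono2) (auto simp: c_def divide_simps)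
    also have "\<dots> = s" using s \<open>1 < p\<close> by (simp add: cR powr_powr)
    finally have 1: "(2 * T * R / \<Delta>) powr (p / (p - 1)) \<le> s" .
    have "r / R = (c * r) / (c * R)" using c by simp
    then have "(r / R) powr \<gamma> = (c * r) powr \<gamma> / (s powr ((p - 1) / p)) powr \<gamma>"
      using c r R unfolding cR by (simp add: powr_divide)
    also have "(s powr ((p - 1) / p)) powr \<gamma> = s powr g"
      by (simp add: powr_powr g_def mult.commute)
    finally have 2: "real l * (r / R) powr \<gamma> = X / s powr g * L"
      using L by (simp add: X_def)
    \<comment> \<open>The critical-point equation for \<open>s\<close>: at the minimum the tail term
      is \<open>s / g\<close>, and the total is
      \<open>s * (1 + 1 / g) = s / (1 - \<eta>)\<close>.\<close>
    have "s powr g * s = s powr (1 + g)" using s by (simp add: powr_add)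
    also have "\<dots> = g * X" using g X by (simp add: s_def powr_powr \<eta>)
    finally have "X / s powr g = s / g" using g s by (simp add: field_simps)
    then have "X / s powr g + s = s / (1 - \<eta>)"
      using \<eta>01 by (simp add: g\<eta> field_simps)
    also have "\<dots> = \<eta> powr (- \<eta>) * (1 - \<eta>) powr (- 1 + \<eta>) * X powr \<eta>"
    proof -
      have "s = (1 - \<eta>) powr \<eta> / \<eta> powr \<eta> * X powr \<eta>"
        using \<eta>01 X by (simp add: s_def g\<eta> powr_mult powr_divide)
      moreover have "(1 - \<eta>) powr (- 1 + \<eta>) = (1 - \<eta>) powr \<eta> / (1 - \<eta>)"
        using \<eta>01 by (simp add: powr_diff)
      ultimately show ?thesis by (simp add: powr_minus_divide)
    qed
    also have "\<dots> = ?B" by (simp add: X_def c_def)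
    finally have 3: "X / s powr g + s = ?B" .
    have "?H \<le> X / s powr g * L + (s + 1) * L"
      using bd[OF R] 1 L unfolding 2
      by (meson add_left_mono add_right_mono less_imp_le mult_right_mono order_trans)
    also have "\<dots> = (?B + 1) * L" unfolding 3[symmetric] by (simp add: algebra_simps)
    \<comment> \<open>The one unit lost to rounding fits well within 64.\<close>
    also have "\<dots> \<le> (?B + 64) * L" using L by (intro mult_right_mono) auto
    finally show ?thesis by (simp add: L_def)
  qed
qed

end
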